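(* Let $X$ be a real normed space with dual $X^*$, let $\varphi\colon X\to(-\infty,\infty]$ be a ("to be decreased" payoff) function, let $\bar x\in\mathrm{dom}\,\varphi$, and consider the loss function $L(x/\bar x):=\varphi(x)-\varphi(\bar x)$ for $x$ in a neighborhood of $\bar x$. Then $x^*\in X^*$ provides a rate of change in a local linear optimistic evaluation of $\varphi$ around $\bar x$ if and only if $x^*\in\partial\varphi(\bar x)$, where $\partial\varphi(\bar x)$ is the (local) classical subdifferential of $\varphi$ at $\bar x$. Furthermore, the same description holds for global evaluations: $x^*$ provides a rate of change in a global linear optimistic evaluation of $\varphi$ around $\bar x$ if and only if the subgradient inequality $\langle x^*,x-\bar x\rangle\le\varphi(x)-\varphi(\bar x)$ holds for all $x\in X$; in particular, when $\varphi$ is convex, $x^*\in\partial\varphi(\bar x)$ if and only if $x^*$ provides a rate of change in a global linear optimistic evaluation of $\varphi$ around $\bar x$.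
   Context: $\mathrm{dom}\,\varphi=\{x\in X:\varphi(x)<\infty\}$. Local classical subdifferential: for $\vartheta\colon X\to(-\infty,\infty]$ finite at $\bar x$, $x^*\in\partial\vartheta(\bar x)$ means that there is a neighborhood $V(\bar x)$ of $\bar x$ with $\langle x^*,x-\bar x\rangle\le\vartheta(x)-\vartheta(\bar x)$ for all $x\in V(\bar x)$. When $V(\bar x)=X$ this is the usual subgradient inequality of convex analysis. Linear optimistic evaluation of a "to be decreased" payoff $\varphi$ around $\bar x$: $x^*\in X^*$ is a rate of change in a local linear optimistic evaluation of $\varphi$ around $\bar x$ if there are a function $l(\cdot/\bar x)\colon X\to(-\infty,\infty]$ with $l(\bar x/\bar x)=\varphi(\bar x)$ and a neighborhood $V(\bar x)$ of $\bar x$ such that, with $E(x/\bar x):=l(x/\bar x)-l(\bar x/\bar x)$, one has $E(x/\bar x)=\langle x^*,x-\bar x\rangle$ and $L(x/\bar x)\ge E(x/\bar x)$ for all $x\in V(\bar x)$. The evaluation is global if this holds with $V(\bar x)=X$. *)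

theory Defs
  imports "HOL-Analysis.Analysis"
begin

text \<open>
  Functions from X to \<open>(-\<infinity>, \<infinity>]\<close> are \<open>ereal\<close>-valued functions that avoid \<open>-\<infinity>\<close>, and the dual
  space is the type \<open>'a \<Rightarrow>\<^sub>L real\<close> of bounded linear functionals. A neighborhood of \<open>xbar\<close> is any
  set, not necessarily open, with \<open>xbar\<close> in its interior.

  The differences \<open>\<phi> x - \<phi> xbar\<close> and \<open>l x - l xbar\<close> have their usual meaning only if \<open>\<phi> xbar\<close> is
  finite, that is, if \<open>xbar \<in> effective_domain \<phi>\<close>; \<open>ereal\<close> subtraction gives them junk values
  otherwise.
\<close>

definition avoids_minus_infinity :: "('a \<Rightarrow> ereal) \<Rightarrow> bool" where
  "avoids_minus_infinity f \<longleftrightarrow> (\<forall>x. f x \<noteq> -\<infinity>)"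

definition effective_domain :: "('a \<Rightarrow> ereal) \<Rightarrow> 'a set" where
  "effective_domain f = {x. f x < \<infinity>}"

definition neighborhood :: "'a::topological_space \<Rightarrow> 'a set \<Rightarrow> bool" where
  "neighborhood x V \<longleftrightarrow> x \<in> interior V"

definition subgradient_on ::
    "'a::real_normed_vector set \<Rightarrow> ('a \<Rightarrow> ereal) \<Rightarrow> 'a \<Rightarrow> ('a \<Rightarrow>\<^sub>L real) \<Rightarrow> bool" where
  "subgradient_on V f xbar xstar \<longleftrightarrow>
     (\<forall>x\<in>V. ereal (blinfun_apply xstar (x - xbar)) \<le> f x - f xbar)"

definition local_subdifferential ::
    "('a::real_normed_vector \<Rightarrow> ereal) \<Rightarrow> 'a \<Rightarrow> ('a \<Rightarrow>\<^sub>L real) set" where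
  "local_subdifferential f xbar =
     {xstar. \<exists>V. neighborhood xbar V \<and> subgradient_on V f xbar xstar}"

definition loss :: "('a \<Rightarrow> ereal) \<Rightarrow> 'a \<Rightarrow> 'a \<Rightarrow> ereal" where
  "loss \<phi> xbar x = \<phi> x - \<phi> xbar"

text \<open>
  For the fixed reference point \<open>xbar\<close>, \<open>l x\<close> stands for \<open>l(x/xbar)\<close>, and \<open>l x - l xbar\<close> is
  the evaluation \<open>E(x/xbar)\<close>.
\<close>

definition linear_optimistic_evaluation_on ::
    "'a::real_normed_vector set \<Rightarrow> ('a \<Rightarrow> ereal) \<Rightarrow> 'a \<Rightarrow> ('a \<Rightarrow> ereal) \<Rightarrow> ('a \<Rightarrow>\<^sub>L real) \<Rightarrow> bool" where
  "linear_optimistic_evaluation_on V \<phi> xbar l xstar \<longleftrightarrow>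
     avoids_minus_infinity l \<and> l xbar = \<phi> xbar \<and>
     (\<forall>x\<in>V. l x - l xbar = ereal (blinfun_apply xstar (x - xbar)) \<and>
            loss \<phi> xbar x \<ge> l x - l xbar)"

definition rate_of_change_local ::
    "('a::real_normed_vector \<Rightarrow> ereal) \<Rightarrow> 'a \<Rightarrow> ('a \<Rightarrow>\<^sub>L real) \<Rightarrow> bool" where
  "rate_of_change_local \<phi> xbar xstar \<longleftrightarrow>
     (\<exists>l V. neighborhood xbar V \<and> linear_optimistic_evaluation_on V \<phi> xbar l xstar)"

definition rate_of_change_global ::
    "('a::real_normed_vector \<Rightarrow> ereal) \<Rightarrow> 'a \<Rightarrow> ('a \<Rightarrow>\<^sub>L real) \<Rightarrow> bool" where
  "rate_of_change_global \<phi> xbar xstar \<longleftrightarrow>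
     (\<exists>l. linear_optimistic_evaluation_on UNIV \<phi> xbar l xstar)"

text \<open>
  The library's \<open>convex_on\<close> covers real-valued functions only. The weights are strictly between
  0 and 1, so the right-hand side never involves \<open>0 * \<infinity>\<close>, and for functions avoiding \<open>-\<infinity>\<close> it
  never involves \<open>\<infinity> - \<infinity>\<close> either.
\<close>

definition ereal_convex :: "('a::real_vector \<Rightarrow> ereal) \<Rightarrow> bool" where
  "ereal_convex f \<longleftrightarrow>
     (\<forall>x y t. 0 < t \<and> t < 1 \<longrightarrow>
        f ((1 - t) *\<^sub>R x + t *\<^sub>R y) \<le> ereal (1 - t) * f x + ereal t * f y)"

end

theory Submission
  imports Defs
begin

text \<open>Since \<open>\<phi> xbar\<close> is finite, the conditions on an evaluation
  \<open>l\<close> force it to equal the affine function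
  \<open>\<phi> xbar + xstar (x - xbar)\<close> on \<open>V\<close>, and its being dominated by the
  loss is then exactly the subgradient inequality on \<open>V\<close>. This holds for every set
  \<open>V\<close>, so \<open>linear_optimistic_evaluation_on_iff_subgradient_on\<close> settles the
  local and global equivalences together. For convex \<open>\<phi>\<close>,
  \<open>ereal_convex_subgradient_on_UNIV\<close> spreads the inequality from a neighborhood to the
  whole space.\<close>

lemma linear_optimistic_evaluation_on_iff_subgradient_on:
  assumes "\<phi> xbar = ereal c"
  shows "(\<exists>l. linear_optimistic_evaluation_on V \<phi> xbar l xstar) \<longleftrightarrow> subgradient_on V \<phi> xbar xstar"
proof
  assume "\<exists>l. linear_optimistic_evaluation_on V \<phi> xbar l xstar"
  then show "subgradient_on V \<phi> xbar xstar"
    by (auto simp: linear_optimistic_evaluation_on_def subgradient_on_def loss_def)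
next
  assume "subgradient_on V \<phi> xbar xstar"
  then have "linear_optimistic_evaluation_on V \<phi> xbar
      (\<lambda>x. ereal (c + blinfun_apply xstar (x - xbar))) xstar"
    using assms
    by (auto simp: linear_optimistic_evaluation_on_def subgradient_on_def loss_def
        avoids_minus_infinity_def)
  then show "\<exists>l. linear_optimistic_evaluation_on V \<phi> xbar l xstar"
    by blast
qed

text \<open>A small step \<open>t\<close> from \<open>xbar\<close> towards \<open>x\<close> ends at
  a point \<open>z\<close> of \<open>V\<close>. There
  \<open>t * xstar (x - xbar) \<le> \<phi> z - \<phi> xbar\<close>, and convexity bounds the
  right-hand side by \<open>t * (\<phi> x - \<phi> xbar)\<close>; then \<open>t\<close>
  cancels.\<close>

lemma ereal_convex_subgradient_on_UNIV:
  assumes convex: "ereal_convex \<phi>"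
    and proper: "avoids_minus_infinity \<phi>"
    and fin: "\<phi> xbar = ereal c"
    and nbhd: "neighborhood xbar V"
    and sub: "subgradient_on V \<phi> xbar xstar"
  shows "subgradient_on UNIV \<phi> xbar xstar"
  unfolding subgradient_on_def
proof
  fix x
  obtain e where e: "e > 0" "ball xbar e \<subseteq> V"
    using nbhd by (auto simp: neighborhood_def mem_interior)
  \<comment> \<open>The bound 1/2 keeps \<open>t\<close> below 1, and the other bound puts
    \<open>z\<close> within \<open>e / 2\<close> of \<open>xbar\<close>. The added 1 keeps the
    denominator positive, and so \<open>t\<close> too, when \<open>x = xbar\<close>.\<close>
  define t where "t = min (1/2) (e / (2 * (norm (x - xbar) + 1)))"
  have n: "norm (x - xbar) + 1 > 0"
    by (smt (verit) norm_ge_zero)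
  then have t: "0 < t" "t < 1"
    using e(1) by (auto simp: t_def)
  define z where "z = (1 - t) *\<^sub>R xbar + t *\<^sub>R x"
  have z: "z - xbar = t *\<^sub>R (x - xbar)"
    by (simp add: z_def algebra_simps)
  have "t * norm (x - xbar) \<le> e / (2 * (norm (x - xbar) + 1)) * (norm (x - xbar) + 1)"
    by (rule mult_mono) (use e(1) in \<open>auto simp: t_def\<close>)
  also have "\<dots> = e / 2"
    using less_imp_neq[OF n] by (simp add: divide_simps)
  also have "\<dots> < e"
    using e(1) by simp
  finally have "norm (z - xbar) < e"
    using t by (simp add: z)
  then have "z \<in> V"
    using e(2) by (auto simp: dist_norm norm_minus_commute)
  then have local_ineq: "ereal (t * blinfun_apply xstar (x - xbar)) \<le> \<phi> z - \<phi> xbar"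
    using sub z by (auto simp: subgradient_on_def blinfun.scaleR_right dest!: bspec[of _ _ z])
  have conv_ineq: "\<phi> z \<le> ereal (1 - t) * \<phi> xbar + ereal t * \<phi> x"
    using convex t by (auto simp: ereal_convex_def z_def)
  show "ereal (blinfun_apply xstar (x - xbar)) \<le> \<phi> x - \<phi> xbar"
  proof (cases "\<phi> x")
    case (real r)
    \<comment> \<open>Convexity bounds \<open>\<phi> z\<close> above by a real number and properness
      excludes -\<infinity>, so both inequalities can be combined over the reals.\<close>
    moreover obtain s where s: "\<phi> z = ereal s"
      using conv_ineq proper real fin
      by (cases "\<phi> z") (auto simp: avoids_minus_infinity_def)
    ultimately have "t * blinfun_apply xstar (x - xbar) \<le> t * (r - c)"
      using conv_ineq local_ineq fin by (simp add: algebra_simps)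
    then show ?thesis
      using t(1) real fin by simp
  next
    case PInf
    then show ?thesis by (simp add: fin)
  next
    case MInf
    then show ?thesis using proper by (simp add: avoids_minus_infinity_def)
  qed
qed

theorem proposition3p4:
  fixes \<phi> :: "'a::real_normed_vector \<Rightarrow> ereal"
    and xbar :: 'a
    and xstar :: "'a \<Rightarrow>\<^sub>L real"
  assumes "avoids_minus_infinity \<phi>"
    and "xbar \<in> effective_domain \<phi>"
  shows "(rate_of_change_local \<phi> xbar xstar \<longleftrightarrow> xstar \<in> local_subdifferential \<phi> xbar) \<and>
    (rate_of_change_global \<phi> xbar xstar \<longleftrightarrow>
       (\<forall>x. ereal (blinfun_apply xstar (x - xbar)) \<le> \<phi> x - \<phi> xbar)) \<and>
    (ereal_convex \<phi> \<longrightarrow>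
       (xstar \<in> local_subdifferential \<phi> xbar \<longleftrightarrow> rate_of_change_global \<phi> xbar xstar))"
proof -
  obtain c where c: "\<phi> xbar = ereal c"
    using assms
    by (cases "\<phi> xbar") (auto simp: avoids_minus_infinity_def effective_domain_def)
  \<comment> \<open>The set \<open>V\<close> stays schematic, to serve both for the neighborhoods in
    \<open>loc\<close> and for \<open>UNIV\<close> in \<open>glob\<close>.\<close>
  note evaluation_iff = linear_optimistic_evaluation_on_iff_subgradient_on[of \<phi> xbar, OF c]
  have loc: "rate_of_change_local \<phi> xbar xstar \<longleftrightarrow> xstar \<in> local_subdifferential \<phi> xbar"
    using evaluation_iff unfolding rate_of_change_local_def local_subdifferential_def by blast
  have glob: "rate_of_change_global \<phi> xbar xstar \<longleftrightarrow> subgradient_on UNIV \<phi> xbar xstar"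
    using evaluation_iff unfolding rate_of_change_global_def by blast
  have "xstar \<in> local_subdifferential \<phi> xbar \<longleftrightarrow> subgradient_on UNIV \<phi> xbar xstar"
    if convex: "ereal_convex \<phi>"
  proof
    assume "xstar \<in> local_subdifferential \<phi> xbar"
    then show "subgradient_on UNIV \<phi> xbar xstar"
      using ereal_convex_subgradient_on_UNIV[OF convex assms(1) c]
      by (auto simp: local_subdifferential_def)
  next
    assume "subgradient_on UNIV \<phi> xbar xstar"
    moreover have "neighborhood xbar UNIV"
      by (simp add: neighborhood_def)
    ultimately show "xstar \<in> local_subdifferential \<phi> xbar"
      unfolding local_subdifferential_def by blast
  qed
  then show ?thesis
    using loc glob by (simp add: subgradient_on_def)
qed

end
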